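(* Let $(\mathfrak{g}, [\cdot,\cdot]_{\mathfrak{g}}, \alpha_{\mathfrak{g}}, \langle\cdot,\cdot\rangle)$ be a Riemannian (regular) Hom-Lie algebra. (i) If $\mathfrak{g}$ has negative sectional curvature, then it admits no non-trivial Killing vector. (ii) If $\mathfrak{g}$ has non-positive sectional curvature, then every Killing vector $v$ is parallel, i.e. $\nabla_x v=0$ for all $x\in\mathfrak{g}$.
   Context: A Hom-Lie algebra is a triple $(\mathfrak{g},[\cdot,\cdot]_{\mathfrak{g}},\alpha_{\mathfrak{g}})$ where $\mathfrak{g}$ is a (here finite-dimensional real) vector space, $[\cdot,\cdot]_{\mathfrak{g}}:\mathfrak{g}\times\mathfrak{g}\to\mathfrak{g}$ is a skew-symmetric bilinear map, and $\alpha_{\mathfrak{g}}:\mathfrak{g}\to\mathfrak{g}$ is a linear map with $\alpha_{\mathfrak{g}}([x,y]_{\mathfrak{g}})=[\alpha_{\mathfrak{g}}(x),\alpha_{\mathfrak{g}}(y)]_{\mathfrak{g}}$ for all $x,y$, such that the Hom-Jacobi identity $[\alpha_{\mathfrak{g}}(x),[y,z]_{\mathfrak{g}}]_{\mathfrak{g}}+[\alpha_{\mathfrak{g}}(y),[z,x]_{\mathfrak{g}}]_{\mathfrak{g}}+[\alpha_{\mathfrak{g}}(z),[x,y]_{\mathfrak{g}}]_{\mathfrak{g}}=0$ holds for all $x,y,z\in\mathfrak{g}$. It is regular if $\alpha_{\mathfrak{g}}$ is invertible; all Hom-Lie algebras are assumed regular. A pseudo-Riemannian Hom-Lie algebra is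 such a triple together with a non-degenerate symmetric bilinear form $\langle\cdot,\cdot\rangle:\mathfrak{g}\times\mathfrak{g}\to\mathbb{R}$ with $\langle\alpha_{\mathfrak{g}}(x),\alpha_{\mathfrak{g}}(y)\rangle=\langle x,y\rangle$ for all $x,y$. It is called Riemannian if $\langle\cdot,\cdot\rangle$ is positive definite. The Hom-Levi-Civita connection is the unique bilinear map $\nabla:\mathfrak{g}\times\mathfrak{g}\to\mathfrak{g}$, $(x,y)\mapsto\nabla_x y$, given by the Koszul formula $$2\langle\nabla_x y,\alpha_{\mathfrak{g}}(z)\rangle=\langle[x,y]_{\mathfrak{g}},\alpha_{\mathfrak{g}}(z)\rangle+\langle[z,y]_{\mathfrak{g}},\alpha_{\mathfrak{g}}(x)\rangle+\langle[z,x]_{\mathfrak{g}},\alpha_{\mathfrak{g}}(y)\rangle$$ for all $x,y,z\in\mathfrak{g}$. It satisfies $[x,y]_{\mathfrak{g}}=\nabla_x y-\nabla_y x$, $\langle\nabla_x y,\alpha_{\mathfrak{g}}(z)\rangle=-\langle\alpha_{\mathfrak{g}}(y),\nabla_x z\rangle$ and $\alpha_{\mathfrak{g}}(\nabla_x y)=\nabla_{\alpha_{\mathfrak{g}}(x)}\alpha_{\mathfrak{g}}(y)$. The curvature tensor is $R(x,y)z=\nabla_{\alpha_{\mathfrak{g}}(x)}\nabla_y z-\nabla_{\alpha_{\mathfrak{g}}(y)}\nabla_x z-\nabla_{[x,y]_{\mathfrak{g}}}\alpha_{\mathfrak{g}}(z)$. For $x,y$ spanning a two-dimensional subspace on which $\langle\cdot,\cdot\rangle$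 is non-degenerate, the sectional curvature is $$K(x,y)=\frac{\langle R(x,y)y,\alpha_{\mathfrak{g}}^2(x)\rangle}{\langle x,x\rangle\langle y,y\rangle-\langle x,y\rangle^2}.$$ Negative (respectively non-positive) sectional curvature means $K(x,y)<0$ (respectively $K(x,y)\le 0$) for all linearly independent $x,y\in\mathfrak{g}$. A vector $v\in\mathfrak{g}$ is Killing if $\langle\nabla_x v,\alpha_{\mathfrak{g}}(y)\rangle=-\langle\nabla_y v,\alpha_{\mathfrak{g}}(x)\rangle$ for all $x,y\in\mathfrak{g}$; it is non-trivial if $v\neq 0$.
   Formalization: Part (i) is stated for dimension different from 1: in dimension 1 negative sectional curvature holds vacuously, the connection vanishes, and every non-zero vector is a non-trivial Killing vector, so the claim fails there. *)

theory Defs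
  imports "HOL-Analysis.Analysis"
begin

section \<open>Hom-Lie algebras\<close>

text \<open>
  The underlying vector space is the whole type \<open>'a\<close>; it is required to be finite-dimensional
  (dimension zero included), and no topology, norm or inner product on \<open>'a\<close> is presupposed.
  Regularity, i.e. invertibility of \<open>\<alpha>\<close>, is part of the definition.
\<close>

locale hom_lie_algebra =
  fixes br :: "'a::real_vector \<Rightarrow> 'a \<Rightarrow> 'a"
    and \<alpha> :: "'a \<Rightarrow> 'a"
  assumes finite_dim: "\<exists>B::'a set. finite B \<and> span B = UNIV"
    and bilinear_br: "bilinear br"
    and skew_br: "br x y = - br y x"
    and linear_alpha: "linear \<alpha>"
    and bij_alpha: "bij \<alpha>"
    and alpha_br: "\<alpha> (br x y) = br (\<alpha> x) (\<alpha> y)"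
    and hom_jacobi: "br (\<alpha> x) (br y z) + br (\<alpha> y) (br z x) + br (\<alpha> z) (br x y) = 0"

locale pseudo_riemannian_hom_lie_algebra = hom_lie_algebra br \<alpha>
  for br :: "'a::real_vector \<Rightarrow> 'a \<Rightarrow> 'a" and \<alpha> +
  fixes g :: "'a \<Rightarrow> 'a \<Rightarrow> real"
  assumes bilinear_g: "bilinear g"
    and sym_g: "g x y = g y x"
    and nondegenerate_g: "(\<And>y. g x y = 0) \<Longrightarrow> x = 0"
    and alpha_g: "g (\<alpha> x) (\<alpha> y) = g x y"

locale riemannian_hom_lie_algebra = pseudo_riemannian_hom_lie_algebra br \<alpha> g
  for br :: "'a::real_vector \<Rightarrow> 'a \<Rightarrow> 'a" and \<alpha> g +
  assumes pos_def_g: "x \<noteq> 0 \<Longrightarrow> 0 < g x x"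


section \<open>The Hom-Levi-Civita connection and curvature\<close>

definition koszul ::
  "('a::real_vector \<Rightarrow> 'a \<Rightarrow> 'a) \<Rightarrow> ('a \<Rightarrow> 'a) \<Rightarrow> ('a \<Rightarrow> 'a \<Rightarrow> real) \<Rightarrow> ('a \<Rightarrow> 'a \<Rightarrow> 'a) \<Rightarrow> bool"
  where "koszul br \<alpha> g D \<longleftrightarrow>
    (\<forall>x y z. 2 * g (D x y) (\<alpha> z) =
       g (br x y) (\<alpha> z) + g (br z y) (\<alpha> x) + g (br z x) (\<alpha> y))"

text \<open>
  \<open>nabla br \<alpha> g x y\<close> is \<open>\<nabla>\<^sub>x y\<close>. It is well defined on every pseudo-Riemannian Hom-Lie algebra,
  see \<open>ex1_nabla\<close> below.
\<close>

definition nabla ::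
  "('a::real_vector \<Rightarrow> 'a \<Rightarrow> 'a) \<Rightarrow> ('a \<Rightarrow> 'a) \<Rightarrow> ('a \<Rightarrow> 'a \<Rightarrow> real) \<Rightarrow> 'a \<Rightarrow> 'a \<Rightarrow> 'a"
  where "nabla br \<alpha> g = (THE D. bilinear D \<and> koszul br \<alpha> g D)"

definition curvature ::
  "('a::real_vector \<Rightarrow> 'a \<Rightarrow> 'a) \<Rightarrow> ('a \<Rightarrow> 'a) \<Rightarrow> ('a \<Rightarrow> 'a \<Rightarrow> real) \<Rightarrow> 'a \<Rightarrow> 'a \<Rightarrow> 'a \<Rightarrow> 'a"
  where "curvature br \<alpha> g x y z =
    nabla br \<alpha> g (\<alpha> x) (nabla br \<alpha> g y z) - nabla br \<alpha> g (\<alpha> y) (nabla br \<alpha> g x z)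
      - nabla br \<alpha> g (br x y) (\<alpha> z)"

text \<open>
  The value is meaningful only where the denominator does not vanish. In the positive definite case
  this holds for all linearly independent \<open>x\<close>, \<open>y\<close>, by Cauchy-Schwarz.
\<close>

definition sectional_curvature ::
  "('a::real_vector \<Rightarrow> 'a \<Rightarrow> 'a) \<Rightarrow> ('a \<Rightarrow> 'a) \<Rightarrow> ('a \<Rightarrow> 'a \<Rightarrow> real) \<Rightarrow> 'a \<Rightarrow> 'a \<Rightarrow> real"
  where "sectional_curvature br \<alpha> g x y =
    g (curvature br \<alpha> g x y y) (\<alpha> (\<alpha> x)) / (g x x * g y y - (g x y)\<^sup>2)"

text \<open>
  Linear independence of the pair \<open>(x, y)\<close> is \<open>x \<noteq> y \<and> independent {x, y}\<close>: for \<open>x = y\<close> the set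
  \<open>{x, y}\<close> is a singleton, and independent as soon as \<open>x \<noteq> 0\<close>.
\<close>

definition negative_sectional_curvature ::
  "('a::real_vector \<Rightarrow> 'a \<Rightarrow> 'a) \<Rightarrow> ('a \<Rightarrow> 'a) \<Rightarrow> ('a \<Rightarrow> 'a \<Rightarrow> real) \<Rightarrow> bool"
  where "negative_sectional_curvature br \<alpha> g \<longleftrightarrow>
    (\<forall>x y. x \<noteq> y \<and> independent {x, y} \<longrightarrow> sectional_curvature br \<alpha> g x y < 0)"

definition nonpositive_sectional_curvature ::
  "('a::real_vector \<Rightarrow> 'a \<Rightarrow> 'a) \<Rightarrow> ('a \<Rightarrow> 'a) \<Rightarrow> ('a \<Rightarrow> 'a \<Rightarrow> real) \<Rightarrow> bool"
  where "nonpositive_sectional_curvature br \<alpha> g \<longleftrightarrow>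
    (\<forall>x y. x \<noteq> y \<and> independent {x, y} \<longrightarrow> sectional_curvature br \<alpha> g x y \<le> 0)"

definition killing ::
  "('a::real_vector \<Rightarrow> 'a \<Rightarrow> 'a) \<Rightarrow> ('a \<Rightarrow> 'a) \<Rightarrow> ('a \<Rightarrow> 'a \<Rightarrow> real) \<Rightarrow> 'a \<Rightarrow> bool"
  where "killing br \<alpha> g v \<longleftrightarrow>
    (\<forall>x y. g (nabla br \<alpha> g x v) (\<alpha> y) = - g (nabla br \<alpha> g y v) (\<alpha> x))"


section \<open>Existence and uniqueness of the connection\<close>

context pseudo_riemannian_hom_lie_algebra
begin

lemma g_eqI:
  assumes "\<And>z. g x (\<alpha> z) = g y (\<alpha> z)"
  shows "x = y"
proof -
  have "g (x - y) w = 0" for w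
  proof -
    obtain z where "w = \<alpha> z" using bij_alpha by (metis bij_pointE)
    with assms show ?thesis by (simp add: bilinear_lsub[OF bilinear_g])
  qed
  then show ?thesis using nondegenerate_g[of "x - y"] by simp
qed

lemma riesz:
  fixes f :: "'a \<Rightarrow> real"
  assumes "linear f"
  shows "\<exists>u. \<forall>z. g u z = f z"
proof -
  obtain B0 :: "'a set" where B0: "finite B0" "span B0 = UNIV" using finite_dim by blast
  obtain B where B: "B \<subseteq> B0" "independent B" "B0 \<subseteq> span B"
    using real_vector.maximal_independent_subset by blast
  have fin: "finite B" using B0 B finite_subset by blast
  have span: "span B = UNIV"
    using B0 B by (metis real_vector.span_mono real_vector.span_span top.extremum_unique)
  interpret V: finite_dimensional_vector_space "scaleR :: real \<Rightarrow> 'a \<Rightarrow> 'a" B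
    using fin span B by unfold_locales (simp_all add: dependent_raw_def span_raw_def)
  define T where "T x = (\<Sum>b\<in>B. g x b *\<^sub>R b)" for x
  have lin_gl: "linear (\<lambda>x. g x b)" and lin_gr: "linear (g b)" for b
    using bilinear_g by (simp_all add: bilinear_def)
  have linT: "linear T"
    unfolding T_def
    by (intro linearI)
       (simp_all add: bilinear_ladd[OF bilinear_g] bilinear_lmul[OF bilinear_g]
          scaleR_left.add scaleR_left_distrib sum.distrib scaleR_sum_right)
  have coeff: "c b = d b"
    if "(\<Sum>b\<in>B. c b *\<^sub>R b) = (\<Sum>b\<in>B. d b *\<^sub>R b)" "b \<in> B" for c d :: "'a \<Rightarrow> real" and b
  proof -
    have "(\<Sum>b\<in>B. (c b - d b) *\<^sub>R b) = 0"
      using that(1) by (simp add: scaleR_left_diff_distrib sum_subtractf)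
    then show ?thesis
      using real_vector.independentD[OF B(2) fin order_refl, of "\<lambda>b. c b - d b" b] that(2) by simp
  qed
  have agree: "h z = k z" if "linear h" "linear k" "\<And>b. b \<in> B \<Longrightarrow> h b = k b"
    for h k :: "'a \<Rightarrow> real" and z
    using linear_eq_on[OF that(1,2), of z B] span that(3) by auto
  have "inj T"
  proof (rule injI)
    fix x y assume "T x = T y"
    then have "\<And>b. b \<in> B \<Longrightarrow> g x b = g y b" using coeff unfolding T_def by blast
    then have "g x z = g y z" for z using agree[OF lin_gr lin_gr] by blast
    then show "x = y" using g_eqI by blast
  qed
  moreover have "Vector_Spaces.linear scaleR scaleR T"
    using linT by (simp add: linear_def)
  ultimately have "surj T" using V.linear_inj_imp_surj by blast
  then obtain u where "T u = (\<Sum>b\<in>B. f b *\<^sub>R b)" by (metis surjD)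
  then have "\<And>b. b \<in> B \<Longrightarrow> g u b = f b" using coeff unfolding T_def by blast
  then show ?thesis using agree[OF lin_gr assms] by blast
qed

lemma ex1_nabla: "\<exists>!D. bilinear D \<and> koszul br \<alpha> g D"
proof -
  define \<phi> where "\<phi> x y z =
    (g (br x y) (\<alpha> z) + g (br z y) (\<alpha> x) + g (br z x) (\<alpha> y)) / 2" for x y z
  note simps = bilinear_ladd[OF bilinear_g] bilinear_radd[OF bilinear_g]
    bilinear_lmul[OF bilinear_g] bilinear_rmul[OF bilinear_g]
    bilinear_ladd[OF bilinear_br] bilinear_radd[OF bilinear_br]
    bilinear_lmul[OF bilinear_br] bilinear_rmul[OF bilinear_br]
    linear_add[OF linear_alpha] linear_scale[OF linear_alpha]
  have "\<exists>u. \<forall>z. g u (\<alpha> z) = \<phi> x y z" for x y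
  proof -
    have "linear (\<phi> x y)"
      unfolding \<phi>_def by (intro linearI) (simp_all add: simps field_simps)
    moreover have "linear (inv \<alpha>)"
    proof (rule linearI)
      have *: "inv \<alpha> w = z" if "w = \<alpha> z" for w z
        using that bij_alpha by (simp add: bij_is_inj)
      have **: "\<alpha> (inv \<alpha> w) = w" for w
        using bij_alpha by (simp add: bij_is_surj surj_f_inv_f)
      show "inv \<alpha> (a + b) = inv \<alpha> a + inv \<alpha> b" for a b
        by (rule *) (simp only: linear_add[OF linear_alpha] **)
      show "inv \<alpha> (r *\<^sub>R a) = r *\<^sub>R inv \<alpha> a" for r a
        by (rule *) (simp only: linear_scale[OF linear_alpha] **)
    qed
    ultimately have "linear (\<phi> x y \<circ> inv \<alpha>)" by (rule linear_compose[rotated])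
    from riesz[OF this] obtain u where "\<forall>z. g u z = \<phi> x y (inv \<alpha> z)" by auto
    then have "g u (\<alpha> z) = \<phi> x y z" for z using bij_alpha by (simp add: bij_is_inj)
    then show ?thesis by blast
  qed
  then obtain D where D: "g (D x y) (\<alpha> z) = \<phi> x y z" for x y z by metis
  have "D x (y + y') = D x y + D x y'" "D (x + x') y = D x y + D x' y"
    "D x (r *\<^sub>R y) = r *\<^sub>R D x y" "D (r *\<^sub>R x) y = r *\<^sub>R D x y" for x x' y y' r
    by (rule g_eqI, simp add: D bilinear_ladd[OF bilinear_g] bilinear_lmul[OF bilinear_g],
        simp add: \<phi>_def simps algebra_simps add_divide_distrib)+
  then have "bilinear D"
    unfolding bilinear_def by (intro conjI allI linearI)
  moreover have "koszul br \<alpha> g D" by (simp add: koszul_def D \<phi>_def)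
  moreover have "D' = D" if "koszul br \<alpha> g D'" for D'
  proof (intro ext g_eqI)
    fix x y z
    from that have "2 * g (D' x y) (\<alpha> z) = 2 * \<phi> x y z" by (simp add: koszul_def \<phi>_def)
    then show "g (D' x y) (\<alpha> z) = g (D x y) (\<alpha> z)" by (simp add: D)
  qed
  ultimately show ?thesis by blast
qed

lemma bilinear_nabla: "bilinear (nabla br \<alpha> g)"
  and koszul_nabla: "koszul br \<alpha> g (nabla br \<alpha> g)"
  using theI'[OF ex1_nabla] by (simp_all add: nabla_def)

end

end

theory Submission
  imports Defs
begin

text \<open>
  Since both \<open>\<nabla>\<^sub>x\<close> and \<open>x \<mapsto> \<nabla>\<^sub>x v\<close> are skew (up to the twist by \<open>\<alpha>\<close>), a Killing vector \<open>v\<close>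
  satisfies \<open>\<nabla>\<^sub>v v = 0\<close>, and expanding the curvature gives the pointwise Bochner identity
  \<open>\<langle>R(x,v)v, \<alpha>\<^sup>2 x\<rangle> = \<langle>\<nabla>\<^sub>x v, \<nabla>\<^sub>x v\<rangle>\<close>. Thus \<open>K(x,v) \<ge> 0\<close>, with equality only if \<open>\<nabla>\<^sub>x v = 0\<close>.
\<close>

context pseudo_riemannian_hom_lie_algebra
begin

abbreviation conn :: "'a \<Rightarrow> 'a \<Rightarrow> 'a" where "conn \<equiv> nabla br \<alpha> g"

lemma koszul_formula:
  "2 * g (conn x y) (\<alpha> z) = g (br x y) (\<alpha> z) + g (br z y) (\<alpha> x) + g (br z x) (\<alpha> y)"
  using koszul_nabla by (simp add: koszul_def)

lemma g_br_swap: "g (br x y) z = - g (br y x) z"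
  by (metis skew_br bilinear_g bilinear_lneg)

lemma nabla_torsion_free: "conn x y - conn y x = br x y"
proof (rule g_eqI)
  fix z
  show "g (conn x y - conn y x) (\<alpha> z) = g (br x y) (\<alpha> z)"
    using koszul_formula[of x y z] koszul_formula[of y x z] g_br_swap[of y x "\<alpha> z"]
    by (simp add: bilinear_lsub[OF bilinear_g])
qed

text \<open>Adding the Koszul formulas for (x, y, z) and (x, z, y), the six bracket terms cancel in
  pairs by skew-symmetry.\<close>

lemma nabla_metric: "g (conn x y) (\<alpha> z) = - g (\<alpha> y) (conn x z)"
  using koszul_formula[of x y z] koszul_formula[of x z y] sym_g[of "\<alpha> y" "conn x z"]
    g_br_swap[of x y "\<alpha> z"] g_br_swap[of x z "\<alpha> y"] g_br_swap[of y z "\<alpha> x"]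
  by linarith

lemma alpha_nabla: "\<alpha> (conn x y) = conn (\<alpha> x) (\<alpha> y)"
proof (rule g_eqI)
  fix z
  \<comment> \<open>With z = \<alpha> w, every argument in the second Koszul formula is an
    \<alpha>-image, and invariance of the bracket and of \<open>g\<close> reduces it to the
    first.\<close>
  obtain w where "z = \<alpha> w" using bij_alpha by (metis bij_pointE)
  then show "g (\<alpha> (conn x y)) (\<alpha> z) = g (conn (\<alpha> x) (\<alpha> y)) (\<alpha> z)"
    using koszul_formula[of x y w] koszul_formula[of "\<alpha> x" "\<alpha> y" "\<alpha> w"]
    by (simp add: alpha_g flip: alpha_br)
qed

lemma killing_skew:
  assumes "killing br \<alpha> g v"
  shows "g (conn x v) (\<alpha> y) = - g (conn y v) (\<alpha> x)"
  using assms unfolding killing_def by blast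

lemma killing_nabla_self:
  assumes "killing br \<alpha> g v"
  shows "conn v v = 0"
proof (rule g_eqI)
  fix z
  have "g (conn z v) (\<alpha> v) = 0"
    using nabla_metric[of z v v] sym_g[of "\<alpha> v" "conn z v"] by simp
  then show "g (conn v v) (\<alpha> z) = g 0 (\<alpha> z)"
    using killing_skew[OF assms, of v z] by (simp add: bilinear_lzero[OF bilinear_g])
qed

lemma killing_curvature:
  assumes "killing br \<alpha> g v"
  shows "g (curvature br \<alpha> g x v v) (\<alpha> (\<alpha> x)) = g (conn x v) (conn x v)"
proof -
  \<comment> \<open>Writing the bracket as \<alpha> w turns
    \<open>conn (br x v) (\<alpha> v)\<close> into \<open>\<alpha> (conn w v)\<close>, to which the
    Killing equation applies.\<close>
  obtain w where w: "br x v = \<alpha> w" using bij_alpha by (metis bij_pointE)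
  have "g (conn (\<alpha> v) (conn x v)) (\<alpha> (\<alpha> x)) = - g (conn x v) (conn v x)"
    by (simp add: nabla_metric alpha_g flip: alpha_nabla)
  moreover have "g (conn (br x v) (\<alpha> v)) (\<alpha> (\<alpha> x)) = - g (conn x v) (br x v)"
    using killing_skew[OF assms, of w x] by (simp add: w alpha_g flip: alpha_nabla)
  moreover have "g (conn x v) (br x v) = g (conn x v) (conn x v) - g (conn x v) (conn v x)"
    by (simp add: bilinear_rsub[OF bilinear_g] flip: nabla_torsion_free)
  ultimately show ?thesis
    by (simp add: curvature_def killing_nabla_self[OF assms] bilinear_rzero[OF bilinear_nabla]
        bilinear_lzero[OF bilinear_g] bilinear_lsub[OF bilinear_g] bilinear_lneg[OF bilinear_g])
qed

end

text \<open>The asymmetric form suits a fixed Killing vector y and a varying direction x.\<close>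

lemma pair_independent_iff:
  fixes x y :: "'a::real_vector"
  shows "x \<noteq> y \<and> independent {x, y} \<longleftrightarrow> y \<noteq> 0 \<and> x \<notin> span {y}"
  by (auto simp: independent_insert span_base)

context riemannian_hom_lie_algebra
begin

lemma g_nonneg: "0 \<le> g x x"
  by (cases "x = 0") (auto simp: bilinear_lzero[OF bilinear_g] dest: pos_def_g)

lemma strict_cauchy_schwarz:
  assumes "y \<noteq> 0" "x \<notin> span {y}"
  shows "0 < g x x * g y y - (g x y)\<^sup>2"
proof -
  \<comment> \<open>\<open>u\<close> is the component of x orthogonal to y, scaled by
    \<open>g y y\<close>; its square norm is \<open>g y y\<close> times the Gram
    determinant.\<close>
  define u where "u = g y y *\<^sub>R x - g x y *\<^sub>R y"
  have pos: "0 < g y y" using pos_def_g assms(1) .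
  have "u \<noteq> 0"
  proof
    assume "u = 0"
    then have "x = (g x y / g y y) *\<^sub>R y"
      using pos by (simp add: u_def eq_vector_fraction_iff)
    then show False using assms(2) by (metis span_base span_scale singletonI)
  qed
  then have "0 < g u u" by (rule pos_def_g)
  also have "g u u = g y y * (g x x * g y y - (g x y)\<^sup>2)"
    using sym_g[of y x]
    by (simp add: u_def bilinear_lsub[OF bilinear_g] bilinear_rsub[OF bilinear_g]
        bilinear_lmul[OF bilinear_g] bilinear_rmul[OF bilinear_g] algebra_simps power2_eq_square)
  finally show ?thesis using pos by (simp add: zero_less_mult_iff)
qed

lemma killing_sectional_curvature:
  assumes "killing br \<alpha> g v" "v \<noteq> 0" "x \<notin> span {v}"
  shows "0 \<le> sectional_curvature br \<alpha> g x v"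
    and "sectional_curvature br \<alpha> g x v \<le> 0 \<Longrightarrow> conn x v = 0"
proof -
  let ?d = "g x x * g v v - (g x v)\<^sup>2"
  have K: "sectional_curvature br \<alpha> g x v = g (conn x v) (conn x v) / ?d"
    by (simp add: sectional_curvature_def killing_curvature[OF assms(1)])
  have d: "0 < ?d" by (rule strict_cauchy_schwarz[OF assms(2,3)])
  show "0 \<le> sectional_curvature br \<alpha> g x v"
    using d g_nonneg by (simp add: K)
  assume "sectional_curvature br \<alpha> g x v \<le> 0"
  then have "g (conn x v) (conn x v) \<le> 0" using d by (simp add: K divide_le_0_iff)
  then show "conn x v = 0" using pos_def_g by fastforce
qed

text \<open>In dimension one the curvature condition is vacuous, while the bracket and the
  connection vanish, so every vector is Killing; hence the dimension hypothesis, which supplies a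
  direction x outside the line of v.\<close>

lemma negative_curvature_no_killing:
  assumes "dim (UNIV :: 'a set) \<noteq> 1" "negative_sectional_curvature br \<alpha> g" "killing br \<alpha> g v"
  shows "v = 0"
proof (rule ccontr)
  assume v: "v \<noteq> 0"
  then have "dim (span {v}) = 1" by (simp add: dim_eq_card_independent)
  then obtain x where "x \<notin> span {v}" using assms(1) by (metis UNIV_eq_I)
  then show False
    using assms(2) killing_sectional_curvature(1)[OF assms(3) v, of x] pair_independent_iff[of x v] v
    unfolding negative_sectional_curvature_def by fastforce
qed

lemma nonpositive_curvature_killing_parallel:
  assumes "nonpositive_sectional_curvature br \<alpha> g" "killing br \<alpha> g v"
  shows "conn x v = 0"
\<comment> \<open>Curvature says nothing about dependent pairs; there linearity and
  \<open>conn v v = 0\<close> suffice.\<close>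
proof (cases "v = 0 \<or> x \<in> span {v}")
  case True
  then show ?thesis
    using killing_nabla_self[OF assms(2)]
    by (auto simp: span_singleton bilinear_lmul[OF bilinear_nabla] bilinear_rzero[OF bilinear_nabla])
next
  case False
  then show ?thesis
    using assms(1) killing_sectional_curvature(2)[OF assms(2), of x] pair_independent_iff[of x v]
    unfolding nonpositive_sectional_curvature_def by blast
qed

end

theorem theorem9:
  fixes br :: "'a::real_vector \<Rightarrow> 'a \<Rightarrow> 'a"
    and \<alpha> :: "'a \<Rightarrow> 'a"
    and g :: "'a \<Rightarrow> 'a \<Rightarrow> real"
  assumes "riemannian_hom_lie_algebra br \<alpha> g"
  shows "(dim (UNIV :: 'a set) \<noteq> 1 \<and> negative_sectional_curvature br \<alpha> g \<longrightarrow>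
            \<not> (\<exists>v. v \<noteq> 0 \<and> killing br \<alpha> g v)) \<and>
         (nonpositive_sectional_curvature br \<alpha> g \<longrightarrow>
            (\<forall>v. killing br \<alpha> g v \<longrightarrow> (\<forall>x. nabla br \<alpha> g x v = 0)))"
proof -
  interpret riemannian_hom_lie_algebra br \<alpha> g by fact
  show ?thesis
    using negative_curvature_no_killing nonpositive_curvature_killing_parallel by blast
qed

end
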